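(* Let $\mathcal{C}$ be a small connected category and let $p_1,p_2\colon \mathcal{C}\times\mathcal{C}\to\mathcal{C}$ be the two projection functors. Then the categorical complexity of $\mathcal{C}$ equals the categorical homotopic distance between the projections: $$\mathrm{cTC}(\mathcal{C})=\mathrm{cD}(p_1,p_2).$$
   Context: Interval category: for $m\ge 0$, $\mathcal{I}_m$ has objects $0,1,\dots,m$ and its only non-identity arrows are: exactly one arrow $r\to s$ whenever $r$ is even and $s=r-1$ or $s=r+1$ (so $0\to 1\leftarrow 2\to\cdots$). Two functors $F,G\colon\mathcal{C}\to\mathcal{D}$ between small categories are homotopic, $F\simeq G$, if for some $m\ge 0$ there is a functor $H\colon\mathcal{C}\times\mathcal{I}_m\to\mathcal{D}$ with $H_0=F$ and $H_m=G$ (equivalently, $F$ and $G$ are joined by a finite zigzag of natural transformations). A small category is connected if any two objects are joined by a finite zigzag of arrows. Members of covers (subcategories) are not required to be connected. Geometric cover: a collection $\{\mathcal{U}_\lambda\}_{\lambda\in\Lambda}$ of subcategories of $\mathcal{C}$ such that for every sequence of composable arrows $f_1,\dots,f_n$ in $\mathcal{C}$ there is $\lambda\in\Lambda$ such that every $f_i$ belongs to $\mathcal{U}_\lambda$. Categorical homotopic distance: for functors $F,G\colon\mathcal{C}\to\mathcal{D}$, $\mathrm{cD}(F,G)$ is the least integer $n\ge 0$ such that there is a geometric cover $\{\mathcal{U}_0,\dots,\mathcal{U}_n\}$ of $\mathcal{C}$ with $F_{|\mathcal{U}_j}\simeq G_{|\mathcal{U}_j}$ for all $j$; it is $\infty$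 if there is no such cover. Categorical complexity: let $\Delta\colon\mathcal{C}\to\mathcal{C}\times\mathcal{C}$ be the diagonal functor. A subcategory $\mathcal{U}$ of $\mathcal{C}\times\mathcal{C}$ is a Farber subcategory if there is a functor $F\colon\mathcal{U}\to\mathcal{C}$ with $\Delta\circ F\simeq i_{\mathcal{U}}$, where $i_{\mathcal{U}}\colon\mathcal{U}\to\mathcal{C}\times\mathcal{C}$ is the inclusion. $\mathrm{cTC}(\mathcal{C})$ is the least integer $n\ge 0$ such that $\mathcal{C}\times\mathcal{C}$ has a geometric cover formed by $n+1$ Farber subcategories, and $\infty$ if there is none. *)

theory Defs
  imports Main "HOL-Library.Extended_Nat"
begin

section \<open>Small categories, functors, products\<close>

record ('o, 'a) cat =
  Obj :: "'o set"
  Arr :: "'a set"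
  Dom :: "'a \<Rightarrow> 'o"
  Cod :: "'a \<Rightarrow> 'o"
  Id  :: "'o \<Rightarrow> 'a"
  Comp :: "'a \<Rightarrow> 'a \<Rightarrow> 'a"  \<comment> \<open>\<open>Comp C g f\<close> is \<open>g\<close> after \<open>f\<close>\<close>

text \<open>All operations are total HOL functions; only their values on the carriers
  (and, for \<open>Comp\<close>, on composable pairs of arrows) are meaningful.\<close>

locale category =
  fixes C :: "('o, 'a) cat"
  assumes dom_obj: "f \<in> Arr C \<Longrightarrow> Dom C f \<in> Obj C"
    and cod_obj: "f \<in> Arr C \<Longrightarrow> Cod C f \<in> Obj C"
    and id_arr: "x \<in> Obj C \<Longrightarrow> Id C x \<in> Arr C"
    and dom_id: "x \<in> Obj C \<Longrightarrow> Dom C (Id C x) = x"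
    and cod_id: "x \<in> Obj C \<Longrightarrow> Cod C (Id C x) = x"
    and comp_arr: "\<lbrakk>f \<in> Arr C; g \<in> Arr C; Cod C f = Dom C g\<rbrakk> \<Longrightarrow> Comp C g f \<in> Arr C"
    and dom_comp: "\<lbrakk>f \<in> Arr C; g \<in> Arr C; Cod C f = Dom C g\<rbrakk> \<Longrightarrow> Dom C (Comp C g f) = Dom C f"
    and cod_comp: "\<lbrakk>f \<in> Arr C; g \<in> Arr C; Cod C f = Dom C g\<rbrakk> \<Longrightarrow> Cod C (Comp C g f) = Cod C g"
    and comp_id_right: "f \<in> Arr C \<Longrightarrow> Comp C f (Id C (Dom C f)) = f"
    and comp_id_left: "f \<in> Arr C \<Longrightarrow> Comp C (Id C (Cod C f)) f = f"
    and comp_assoc: "\<lbrakk>f \<in> Arr C; g \<in> Arr C; h \<in> Arr C; Cod C f = Dom C g; Cod C g = Dom C h\<rbrakk>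
      \<Longrightarrow> Comp C h (Comp C g f) = Comp C (Comp C h g) f"

definition connected_cat :: "('o, 'a) cat \<Rightarrow> bool" where
  "connected_cat C \<longleftrightarrow>
    (\<forall>x\<in>Obj C. \<forall>y\<in>Obj C. equivclp (\<lambda>u v. \<exists>f\<in>Arr C. Dom C f = u \<and> Cod C f = v) x y)"

record ('o1, 'a1, 'o2, 'a2) fctr =
  fobj :: "'o1 \<Rightarrow> 'o2"
  farr :: "'a1 \<Rightarrow> 'a2"

locale is_functor = A: category A + B: category B
  for A :: "('o1, 'a1) cat" and B :: "('o2, 'a2) cat" +
  fixes F :: "('o1, 'a1, 'o2, 'a2) fctr"
  assumes fobj_obj: "x \<in> Obj A \<Longrightarrow> fobj F x \<in> Obj B"
    and farr_arr: "f \<in> Arr A \<Longrightarrow> farr F f \<in> Arr B"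
    and farr_dom: "f \<in> Arr A \<Longrightarrow> Dom B (farr F f) = fobj F (Dom A f)"
    and farr_cod: "f \<in> Arr A \<Longrightarrow> Cod B (farr F f) = fobj F (Cod A f)"
    and farr_id: "x \<in> Obj A \<Longrightarrow> farr F (Id A x) = Id B (fobj F x)"
    and farr_comp: "\<lbrakk>f \<in> Arr A; g \<in> Arr A; Cod A f = Dom A g\<rbrakk>
      \<Longrightarrow> farr F (Comp A g f) = Comp B (farr F g) (farr F f)"

text \<open>Equality of functors with source \<open>A\<close>: values off the carriers of \<open>A\<close> are ignored.\<close>

definition fctr_eq ::
  "('o1, 'a1) cat \<Rightarrow> ('o1, 'a1, 'o2, 'a2) fctr \<Rightarrow> ('o1, 'a1, 'o2, 'a2) fctr \<Rightarrow> bool" where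
  "fctr_eq A F G \<longleftrightarrow>
    (\<forall>x\<in>Obj A. fobj F x = fobj G x) \<and> (\<forall>f\<in>Arr A. farr F f = farr G f)"

definition fctr_comp ::
  "('o2, 'a2, 'o3, 'a3) fctr \<Rightarrow> ('o1, 'a1, 'o2, 'a2) fctr \<Rightarrow> ('o1, 'a1, 'o3, 'a3) fctr"
  (infixl "\<circ>\<^sub>F" 55) where
  "G \<circ>\<^sub>F F = \<lparr>fobj = fobj G \<circ> fobj F, farr = farr G \<circ> farr F\<rparr>"

definition prod_cat :: "('o1, 'a1) cat \<Rightarrow> ('o2, 'a2) cat \<Rightarrow> ('o1 \<times> 'o2, 'a1 \<times> 'a2) cat"
  (infixr "\<times>\<^sub>C" 80) where
  "A \<times>\<^sub>C B = \<lparr>Obj = Obj A \<times> Obj B, Arr = Arr A \<times> Arr B,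
    Dom = map_prod (Dom A) (Dom B), Cod = map_prod (Cod A) (Cod B),
    Id = map_prod (Id A) (Id B),
    Comp = (\<lambda>g f. (Comp A (fst g) (fst f), Comp B (snd g) (snd f)))\<rparr>"

definition proj1 :: "('o1 \<times> 'o2, 'a1 \<times> 'a2, 'o1, 'a1) fctr" where
  "proj1 = \<lparr>fobj = fst, farr = fst\<rparr>"

definition proj2 :: "('o1 \<times> 'o2, 'a1 \<times> 'a2, 'o2, 'a2) fctr" where
  "proj2 = \<lparr>fobj = snd, farr = snd\<rparr>"

definition diag :: "('o, 'a, 'o \<times> 'o, 'a \<times> 'a) fctr" where
  "diag = \<lparr>fobj = (\<lambda>x. (x, x)), farr = (\<lambda>f. (f, f))\<rparr>"

lemma category_prod_cat: "category A \<Longrightarrow> category B \<Longrightarrow> category (A \<times>\<^sub>C B)"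
  unfolding category_def prod_cat_def by auto

lemma is_functor_proj1: "category A \<Longrightarrow> category B \<Longrightarrow> is_functor (A \<times>\<^sub>C B) A proj1"
  by (intro is_functor.intro category_prod_cat)
    (auto simp: is_functor_axioms_def prod_cat_def proj1_def)

lemma is_functor_proj2: "category A \<Longrightarrow> category B \<Longrightarrow> is_functor (A \<times>\<^sub>C B) B proj2"
  by (intro is_functor.intro category_prod_cat)
    (auto simp: is_functor_axioms_def prod_cat_def proj2_def)

lemma is_functor_diag: "category C \<Longrightarrow> is_functor C (C \<times>\<^sub>C C) diag"
  by (intro is_functor.intro category_prod_cat)
    (auto simp: is_functor_axioms_def prod_cat_def diag_def)


section \<open>Interval categories and homotopy\<close>

text \<open>The pair \<open>(r, s)\<close> encodes the unique arrow from \<open>r\<close> to \<open>s\<close>.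
  Two non-identity arrows are never composable, since they go from even to odd numbers.\<close>

definition interval_cat :: "nat \<Rightarrow> (nat, nat \<times> nat) cat" where
  "interval_cat m = \<lparr>Obj = {0..m},
    Arr = {(r, s). r \<le> m \<and> s \<le> m \<and> (r = s \<or> even r \<and> (s = r + 1 \<or> r = s + 1))},
    Dom = fst, Cod = snd, Id = (\<lambda>r. (r, r)), Comp = (\<lambda>g f. (fst f, snd g))\<rparr>"

lemma category_interval_cat: "category (interval_cat m)"
  by unfold_locales (auto simp: interval_cat_def)

text \<open>The restriction \<open>H\<^sub>r\<close> of a functor \<open>H\<close> on \<open>A \<times> interval_cat m\<close> to \<open>A \<times> {r}\<close>.\<close>

definition stage ::
  "('o1 \<times> nat, 'a1 \<times> (nat \<times> nat), 'o2, 'a2) fctr \<Rightarrow> nat \<Rightarrow> ('o1, 'a1, 'o2, 'a2) fctr" where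
  "stage H r = \<lparr>fobj = (\<lambda>x. fobj H (x, r)), farr = (\<lambda>f. farr H (f, (r, r)))\<rparr>"

definition homotopic :: "('o1, 'a1) cat \<Rightarrow> ('o2, 'a2) cat \<Rightarrow>
    ('o1, 'a1, 'o2, 'a2) fctr \<Rightarrow> ('o1, 'a1, 'o2, 'a2) fctr \<Rightarrow> bool" where
  "homotopic A B F G \<longleftrightarrow>
    (\<exists>m H. is_functor (A \<times>\<^sub>C interval_cat m) B H \<and>
      fctr_eq A (stage H 0) F \<and> fctr_eq A (stage H m) G)"


section \<open>Subcategories and geometric covers\<close>

definition subcategory :: "('o, 'a) cat \<Rightarrow> ('o, 'a) cat \<Rightarrow> bool" where
  "subcategory U C \<longleftrightarrow> category U \<and> Obj U \<subseteq> Obj C \<and> Arr U \<subseteq> Arr C \<and>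
    (\<forall>f\<in>Arr U. Dom U f = Dom C f \<and> Cod U f = Cod C f) \<and>
    (\<forall>x\<in>Obj U. Id U x = Id C x) \<and>
    (\<forall>f\<in>Arr U. \<forall>g\<in>Arr U. Cod U f = Dom U g \<longrightarrow> Comp U g f = Comp C g f)"

text \<open>The inclusion of a subcategory \<open>U\<close>: it is given by the identity maps whatever \<open>U\<close> is,
  so \<open>U\<close> only enters as the source of the functor.
  Hence \<open>F \<circ>\<^sub>F incl\<close>, regarded as a functor on \<open>U\<close>, is the restriction of \<open>F\<close> to \<open>U\<close>.\<close>

definition incl :: "('o, 'a, 'o, 'a) fctr" where
  "incl = \<lparr>fobj = id, farr = id\<rparr>"

lemma is_functor_incl: "category C \<Longrightarrow> subcategory U C \<Longrightarrow> is_functor U C incl"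
  unfolding is_functor_def is_functor_axioms_def subcategory_def incl_def by auto

definition composable_seq :: "('o, 'a) cat \<Rightarrow> 'a list \<Rightarrow> bool" where
  "composable_seq C fs \<longleftrightarrow>
    fs \<noteq> [] \<and> set fs \<subseteq> Arr C \<and> successively (\<lambda>f g. Cod C f = Dom C g) fs"

definition geometric_cover :: "('o, 'a) cat \<Rightarrow> 'i set \<Rightarrow> ('i \<Rightarrow> ('o, 'a) cat) \<Rightarrow> bool" where
  "geometric_cover C \<Lambda> U \<longleftrightarrow> (\<forall>l\<in>\<Lambda>. subcategory (U l) C) \<and>
    (\<forall>fs. composable_seq C fs \<longrightarrow> (\<exists>l\<in>\<Lambda>. set fs \<subseteq> Arr (U l)))"


section \<open>Categorical homotopic distance and categorical complexity\<close>

definition least_or_infinity :: "(nat \<Rightarrow> bool) \<Rightarrow> enat" where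
  "least_or_infinity P = (if \<exists>n. P n then enat (LEAST n. P n) else \<infinity>)"

definition cD :: "('o1, 'a1) cat \<Rightarrow> ('o2, 'a2) cat \<Rightarrow>
    ('o1, 'a1, 'o2, 'a2) fctr \<Rightarrow> ('o1, 'a1, 'o2, 'a2) fctr \<Rightarrow> enat" where
  "cD A B F G = least_or_infinity (\<lambda>n. \<exists>U. geometric_cover A {0..n} U \<and>
    (\<forall>j\<in>{0..n}. homotopic (U j) B (F \<circ>\<^sub>F incl) (G \<circ>\<^sub>F incl)))"

definition farber_subcategory :: "('o, 'a) cat \<Rightarrow> ('o \<times> 'o, 'a \<times> 'a) cat \<Rightarrow> bool" where
  "farber_subcategory C U \<longleftrightarrow> subcategory U (C \<times>\<^sub>C C) \<and>
    (\<exists>F. is_functor U C F \<and> homotopic U (C \<times>\<^sub>C C) (diag \<circ>\<^sub>F F) incl)"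

definition cTC :: "('o, 'a) cat \<Rightarrow> enat" where
  "cTC C = least_or_infinity (\<lambda>n. \<exists>U. geometric_cover (C \<times>\<^sub>C C) {0..n} U \<and>
    (\<forall>j\<in>{0..n}. farber_subcategory C (U j)))"

end

theory Submission
  imports Defs
begin

text \<open>
  Both invariants are least numbers of members of a geometric cover of \<open>C \<times>\<^sub>C C\<close>, so it is enough
  that they ask the same condition of each member: a subcategory \<open>U\<close> is Farber if and only if the
  restrictions to \<open>U\<close> of the two projections are homotopic (\<open>farber_iff_proj_homotopic\<close>).

  If \<open>diag \<circ>\<^sub>F F\<close> is homotopic to the inclusion, composing the homotopy with each projection shows
  that \<open>F\<close> is homotopic to both restricted projections, and these are then homotopic to each other
  because homotopy is symmetric and transitive. Conversely, a homotopy \<open>H\<close> from \<open>proj1\<close> to \<open>proj2\<close>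
  on \<open>U\<close>, used as the second component next to the constant homotopy at \<open>proj1\<close>, is a homotopy
  from \<open>(proj1, proj1)\<close>, which is \<open>diag \<circ>\<^sub>F proj1\<close>, to \<open>(proj1, proj2)\<close>, which is the inclusion;
  hence \<open>F = proj1\<close> witnesses that \<open>U\<close> is Farber.

  The technical point is that homotopy is an equivalence relation. As the arrows of
  \<open>interval_cat m\<close> leave the even objects, reversing an interval or attaching a second one at its
  end respects the direction of the arrows only when \<open>m\<close> is even. A homotopy of odd length is
  therefore first prolonged by a constant step.
\<close>

section \<open>Constructions on functors\<close>

definition pair_fctr ::
  "('o1, 'a1, 'o2, 'a2) fctr \<Rightarrow> ('o1, 'a1, 'o3, 'a3) fctr \<Rightarrow> ('o1, 'a1, 'o2 \<times> 'o3, 'a2 \<times> 'a3) fctr"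
  where "pair_fctr F G =
    \<lparr>fobj = (\<lambda>x. (fobj F x, fobj G x)), farr = (\<lambda>f. (farr F f, farr G f))\<rparr>"

lemma is_functor_fctr_comp:
  assumes "is_functor A B F" and "is_functor B D G"
  shows "is_functor A D (G \<circ>\<^sub>F F)"
  using assms unfolding is_functor_def is_functor_axioms_def fctr_comp_def by simp

lemma is_functor_pair_fctr:
  assumes "is_functor A B F" and "is_functor A D G"
  shows "is_functor A (B \<times>\<^sub>C D) (pair_fctr F G)"
proof -
  have "category (B \<times>\<^sub>C D)"
    using assms by (simp add: is_functor_def category_prod_cat)
  then show ?thesis
    using assms unfolding is_functor_def is_functor_axioms_def
    by (simp add: pair_fctr_def prod_cat_def)
qed


section \<open>Homotopies as functors on a cylinder\<close>

lemma Obj_cylinder: "(x, r) \<in> Obj (A \<times>\<^sub>C interval_cat m) \<longleftrightarrow> x \<in> Obj A \<and> r \<le> m"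
  by (auto simp: prod_cat_def interval_cat_def)

lemma Arr_cylinder: "(f, r, s) \<in> Arr (A \<times>\<^sub>C interval_cat m) \<longleftrightarrow>
    f \<in> Arr A \<and> (r, s) \<in> Arr (interval_cat m)"
  by (auto simp: prod_cat_def)

lemma cylinder_simps:
  "Dom (A \<times>\<^sub>C interval_cat m) (f, r, s) = (Dom A f, r)"
  "Cod (A \<times>\<^sub>C interval_cat m) (f, r, s) = (Cod A f, s)"
  "Id (A \<times>\<^sub>C interval_cat m) (x, r) = (Id A x, r, r)"
  "Comp (A \<times>\<^sub>C interval_cat m) (g, s', t) (f, r, s) = (Comp A g f, r, t)"
  by (simp_all add: prod_cat_def interval_cat_def)

lemma Arr_interval_iff: "(r, s) \<in> Arr (interval_cat m) \<longleftrightarrow>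
    r \<le> m \<and> s \<le> m \<and> (r = s \<or> even r \<and> (s = r + 1 \<or> r = s + 1))"
  by (simp add: interval_cat_def)

lemmas cylinder = Obj_cylinder Arr_cylinder cylinder_simps

definition reindex_fctr :: "(nat \<Rightarrow> nat) \<Rightarrow>
    ('o \<times> nat, 'a \<times> nat \<times> nat, 'o \<times> nat, 'a \<times> nat \<times> nat) fctr" where
  "reindex_fctr \<phi> = \<lparr>fobj = map_prod id \<phi>, farr = map_prod id (map_prod \<phi> \<phi>)\<rparr>"

text \<open>Composites in an interval category are determined by their end points, so any map of objects
  that carries arrows to arrows is a functor; it may collapse arrows to identities.\<close>

lemma is_functor_reindex_fctr:
  assumes "category A"
    and "\<And>r s. (r, s) \<in> Arr (interval_cat n) \<Longrightarrow> (\<phi> r, \<phi> s) \<in> Arr (interval_cat m)"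
  shows "is_functor (A \<times>\<^sub>C interval_cat n) (A \<times>\<^sub>C interval_cat m) (reindex_fctr \<phi>)"
proof -
  have "\<phi> r \<le> m" if "r \<le> n" for r
    using assms(2)[of r r] that by (simp add: Arr_interval_iff)
  moreover have "category (A \<times>\<^sub>C interval_cat n)" "category (A \<times>\<^sub>C interval_cat m)"
    using assms(1) by (simp_all add: category_prod_cat category_interval_cat)
  ultimately show ?thesis
    using assms(2) unfolding is_functor_def is_functor_axioms_def
    by (auto simp: reindex_fctr_def cylinder)
qed

lemma homotopicI:
  assumes "is_functor (A \<times>\<^sub>C interval_cat m) B H"
    and "fctr_eq A (stage H 0) F" and "fctr_eq A (stage H m) G"
  shows "homotopic A B F G"
  using assms unfolding homotopic_def by blast

text \<open>A homotopy of odd length \<open>m\<close> is prolonged by collapsing the additional arrow from \<open>m + 1\<close>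
  to \<open>m\<close>.\<close>

lemma homotopic_even_length:
  assumes "category A" and "homotopic A B F G"
  obtains m H where "even m" "is_functor (A \<times>\<^sub>C interval_cat m) B H"
    "fctr_eq A (stage H 0) F" "fctr_eq A (stage H m) G"
proof -
  obtain m H where H: "is_functor (A \<times>\<^sub>C interval_cat m) B H"
      "fctr_eq A (stage H 0) F" "fctr_eq A (stage H m) G"
    using assms(2) unfolding homotopic_def by blast
  show thesis
  proof (cases "even m")
    case True
    then show thesis using that H by blast
  next
    case False
    let ?\<phi> = "min m" and ?n = "Suc m"
    let ?K = "H \<circ>\<^sub>F reindex_fctr ?\<phi>"
    have "is_functor (A \<times>\<^sub>C interval_cat ?n) (A \<times>\<^sub>C interval_cat m) (reindex_fctr ?\<phi>)"
      using False
      by (intro is_functor_reindex_fctr[OF assms(1)])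
        (auto simp: Arr_interval_iff min_def le_Suc_eq not_le, presburger)
    then have "is_functor (A \<times>\<^sub>C interval_cat ?n) B ?K"
      using H(1) by (rule is_functor_fctr_comp)
    moreover have "stage ?K 0 = stage H 0" "stage ?K ?n = stage H m"
      by (simp_all add: stage_def fctr_comp_def reindex_fctr_def)
    ultimately show thesis
      using that[of ?n ?K] H(2,3) False by simp
  qed
qed

lemma homotopic_sym:
  assumes "category A" and "homotopic A B F G"
  shows "homotopic A B G F"
proof -
  obtain m H where H: "even m" "is_functor (A \<times>\<^sub>C interval_cat m) B H"
      "fctr_eq A (stage H 0) F" "fctr_eq A (stage H m) G"
    using assms by (rule homotopic_even_length)
  let ?\<phi> = "\<lambda>r. m - r"
  let ?K = "H \<circ>\<^sub>F reindex_fctr ?\<phi>"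
  have "is_functor (A \<times>\<^sub>C interval_cat m) (A \<times>\<^sub>C interval_cat m) (reindex_fctr ?\<phi>)"
    using H(1) by (intro is_functor_reindex_fctr[OF assms(1)]) (auto simp: Arr_interval_iff)
  then have "is_functor (A \<times>\<^sub>C interval_cat m) B ?K"
    using H(2) by (rule is_functor_fctr_comp)
  moreover have "stage ?K 0 = stage H m" "stage ?K m = stage H 0"
    by (simp_all add: stage_def fctr_comp_def reindex_fctr_def)
  ultimately show ?thesis
    using H(3,4) by (auto intro: homotopicI)
qed

definition concat_homotopy :: "nat \<Rightarrow>
    ('o1 \<times> nat, 'a1 \<times> nat \<times> nat, 'o2, 'a2) fctr \<Rightarrow> ('o1 \<times> nat, 'a1 \<times> nat \<times> nat, 'o2, 'a2) fctr \<Rightarrow>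
    ('o1 \<times> nat, 'a1 \<times> nat \<times> nat, 'o2, 'a2) fctr" where
  "concat_homotopy m H K =
    \<lparr>fobj = (\<lambda>(x, r). if r \<le> m then fobj H (x, r) else fobj K (x, r - m)),
     farr = (\<lambda>(f, r, s). if r \<le> m \<and> s \<le> m then farr H (f, r, s) else farr K (f, r - m, s - m))\<rparr>"

text \<open>For even \<open>m\<close> the arrows at the object \<open>m\<close> of the long interval point away from it, as do
  those at the end of the first and at the start of the second interval. Of two composable arrows
  of an interval category one is an identity, so composable arrows of the long cylinder lie in the
  same half. Functoriality is thus inherited from \<open>H\<close> or from \<open>K\<close>, and the only thing to compare is
  their common stage, which belongs to both halves.\<close>

lemma is_functor_concat_homotopy:
  assumes H: "is_functor (A \<times>\<^sub>C interval_cat m) B H"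
    and K: "is_functor (A \<times>\<^sub>C interval_cat n) B K"
    and m: "even m" and A: "category A"
    and agree: "fctr_eq A (stage H m) (stage K 0)"
  shows "is_functor (A \<times>\<^sub>C interval_cat (m + n)) B (concat_homotopy m H K)" (is "is_functor ?Z B ?L")
proof -
  interpret A: category A by fact
  interpret H: is_functor "A \<times>\<^sub>C interval_cat m" B H by fact
  interpret K: is_functor "A \<times>\<^sub>C interval_cat n" B K by fact
  have Z: "category ?Z"
    using A by (simp add: category_prod_cat category_interval_cat)
  have lo_obj: "fobj ?L (x, r) = fobj H (x, r)" if "r \<le> m" for x r
    using that by (simp add: concat_homotopy_def)
  have hi_obj: "fobj ?L (x, r) = fobj K (x, r - m)" if "m \<le> r" "x \<in> Obj A" for x r
    using that agree by (cases "r = m") (auto simp: concat_homotopy_def fctr_eq_def stage_def)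
  have lo_arr: "farr ?L (f, r, s) = farr H (f, r, s)" if "r \<le> m" "s \<le> m" for f r s
    using that by (simp add: concat_homotopy_def)
  have hi_arr: "farr ?L (f, r, s) = farr K (f, r - m, s - m)"
    if "m \<le> r" "m \<le> s" "f \<in> Arr A" for f r s
    using that agree by (cases "r = m \<and> s = m") (auto simp: concat_homotopy_def fctr_eq_def stage_def)
  have halves: "r \<le> m \<and> s \<le> m \<and> (r, s) \<in> Arr (interval_cat m) \<or>
      m \<le> r \<and> m \<le> s \<and> (r - m, s - m) \<in> Arr (interval_cat n)"
    if "(r, s) \<in> Arr (interval_cat (m + n))" for r s
    using that m by (auto simp: Arr_interval_iff)
  have same_half:
    "r \<le> m \<and> s \<le> m \<and> t \<le> m \<and> (r, s) \<in> Arr (interval_cat m) \<and> (s, t) \<in> Arr (interval_cat m) \<or>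
     m \<le> r \<and> m \<le> s \<and> m \<le> t \<and> (r - m, s - m) \<in> Arr (interval_cat n) \<and>
       (s - m, t - m) \<in> Arr (interval_cat n)"
    if "(r, s) \<in> Arr (interval_cat (m + n))" "(s, t) \<in> Arr (interval_cat (m + n))" for r s t
    using that m by (auto simp: Arr_interval_iff)
  have obj: "fobj ?L (x, r) \<in> Obj B" if "x \<in> Obj A" "r \<le> m + n" for x r
    using that H.fobj_obj[of "(x, r)"] K.fobj_obj[of "(x, r - m)"] hi_obj[of r x]
    by (cases "r \<le> m") (auto simp: cylinder lo_obj)
  have ident: "farr ?L (Id A x, r, r) = Id B (fobj ?L (x, r))" if "x \<in> Obj A" "r \<le> m + n" for x r
    using that H.farr_id[of "(x, r)"] K.farr_id[of "(x, r - m)"] hi_obj[of r x]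
      hi_arr[of r r "Id A x"] A.id_arr[of x]
    by (cases "r \<le> m") (auto simp: cylinder lo_obj lo_arr)
  have arr: "farr ?L (f, r, s) \<in> Arr B \<and> Dom B (farr ?L (f, r, s)) = fobj ?L (Dom A f, r) \<and>
      Cod B (farr ?L (f, r, s)) = fobj ?L (Cod A f, s)"
    if f: "f \<in> Arr A" and rs: "(r, s) \<in> Arr (interval_cat (m + n))" for f r s
    using halves[OF rs]
  proof
    assume "r \<le> m \<and> s \<le> m \<and> (r, s) \<in> Arr (interval_cat m)"
    then show ?thesis
      using f H.farr_arr[of "(f, r, s)"] H.farr_dom[of "(f, r, s)"] H.farr_cod[of "(f, r, s)"]
      by (simp add: cylinder lo_obj lo_arr)
  next
    assume "m \<le> r \<and> m \<le> s \<and> (r - m, s - m) \<in> Arr (interval_cat n)"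
    then show ?thesis
      using f K.farr_arr[of "(f, r - m, s - m)"] K.farr_dom[of "(f, r - m, s - m)"]
        K.farr_cod[of "(f, r - m, s - m)"]
      by (simp add: cylinder hi_obj hi_arr A.dom_obj A.cod_obj)
  qed
  have comp: "farr ?L (Comp A g f, r, t) = Comp B (farr ?L (g, s, t)) (farr ?L (f, r, s))"
    if fg: "f \<in> Arr A" "g \<in> Arr A" "Cod A f = Dom A g"
      and rst: "(r, s) \<in> Arr (interval_cat (m + n))" "(s, t) \<in> Arr (interval_cat (m + n))"
    for f g r s t
    using same_half[OF rst]
  proof
    assume "r \<le> m \<and> s \<le> m \<and> t \<le> m \<and> (r, s) \<in> Arr (interval_cat m) \<and> (s, t) \<in> Arr (interval_cat m)"
    then show ?thesis
      using fg H.farr_comp[of "(f, r, s)" "(g, s, t)"] by (simp add: cylinder lo_arr)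
  next
    assume "m \<le> r \<and> m \<le> s \<and> m \<le> t \<and> (r - m, s - m) \<in> Arr (interval_cat n) \<and>
       (s - m, t - m) \<in> Arr (interval_cat n)"
    then show ?thesis
      using fg K.farr_comp[of "(f, r - m, s - m)" "(g, s - m, t - m)"]
      by (simp add: cylinder hi_arr A.comp_arr)
  qed
  show ?thesis
    using Z H.B.category_axioms obj ident arr comp
    unfolding is_functor_def is_functor_axioms_def by (auto simp: cylinder)
qed

lemma homotopic_trans:
  assumes "category A" and "homotopic A B F G" and "homotopic A B G E"
  shows "homotopic A B F E"
proof -
  obtain m H where H: "even m" "is_functor (A \<times>\<^sub>C interval_cat m) B H"
      "fctr_eq A (stage H 0) F" "fctr_eq A (stage H m) G"
    using assms(1,2) by (rule homotopic_even_length)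
  obtain n K where K: "is_functor (A \<times>\<^sub>C interval_cat n) B K"
      "fctr_eq A (stage K 0) G" "fctr_eq A (stage K n) E"
    using assms(3) unfolding homotopic_def by blast
  let ?L = "concat_homotopy m H K"
  have agree: "fctr_eq A (stage H m) (stage K 0)"
    using H(4) K(2) by (simp add: fctr_eq_def)
  have "is_functor (A \<times>\<^sub>C interval_cat (m + n)) B ?L"
    using is_functor_concat_homotopy H(2) K(1) H(1) assms(1) agree by blast
  moreover have "fctr_eq A (stage ?L 0) F"
    using H(3) by (simp add: fctr_eq_def stage_def concat_homotopy_def)
  \<comment> \<open>If \<open>n = 0\<close>, the last stage of the concatenation is the last stage of \<open>H\<close>.\<close>
  moreover have "fctr_eq A (stage ?L (m + n)) E"
    using agree K(3) by (cases "n = 0") (simp_all add: fctr_eq_def stage_def concat_homotopy_def)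
  ultimately show ?thesis
    by (rule homotopicI)
qed

lemma homotopic_fctr_comp_left:
  assumes "homotopic A B F G" and "is_functor B D P"
  shows "homotopic A D (P \<circ>\<^sub>F F) (P \<circ>\<^sub>F G)"
proof -
  obtain m H where H: "is_functor (A \<times>\<^sub>C interval_cat m) B H"
      "fctr_eq A (stage H 0) F" "fctr_eq A (stage H m) G"
    using assms(1) unfolding homotopic_def by blast
  have "is_functor (A \<times>\<^sub>C interval_cat m) D (P \<circ>\<^sub>F H)"
    using H(1) assms(2) by (rule is_functor_fctr_comp)
  then show ?thesis
    using H(2,3) by (elim homotopicI) (simp_all add: fctr_eq_def stage_def fctr_comp_def)
qed

lemma homotopic_pair_fctr_right:
  assumes "is_functor A B E" and "homotopic A D F G"
  shows "homotopic A (B \<times>\<^sub>C D) (pair_fctr E F) (pair_fctr E G)"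
proof -
  obtain m H where H: "is_functor (A \<times>\<^sub>C interval_cat m) D H"
      "fctr_eq A (stage H 0) F" "fctr_eq A (stage H m) G"
    using assms(2) unfolding homotopic_def by blast
  \<comment> \<open>\<open>E \<circ>\<^sub>F proj1\<close> is the constant homotopy at \<open>E\<close>.\<close>
  have "is_functor (A \<times>\<^sub>C interval_cat m) A proj1"
    using assms(1) by (blast intro: is_functor_proj1 category_interval_cat is_functor.axioms(1))
  then have "is_functor (A \<times>\<^sub>C interval_cat m) (B \<times>\<^sub>C D) (pair_fctr (E \<circ>\<^sub>F proj1) H)"
    using assms(1) H(1) by (blast intro: is_functor_pair_fctr is_functor_fctr_comp)
  then show ?thesis
    using H(2,3)
    by (elim homotopicI) (simp_all add: fctr_eq_def stage_def fctr_comp_def pair_fctr_def proj1_def)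
qed


section \<open>Farber subcategories\<close>

lemma farber_iff_proj_homotopic:
  fixes C :: "('o, 'a) cat"
  assumes C: "category C" and U: "subcategory U (C \<times>\<^sub>C C)"
  shows "farber_subcategory C U \<longleftrightarrow> homotopic U C (proj1 \<circ>\<^sub>F incl) (proj2 \<circ>\<^sub>F incl)"
proof
  have catU: "category U"
    using U by (simp add: subcategory_def)
  assume "farber_subcategory C U"
  then obtain F where F: "homotopic U (C \<times>\<^sub>C C) (diag \<circ>\<^sub>F F) incl"
    unfolding farber_subcategory_def by blast
  have "proj1 \<circ>\<^sub>F (diag \<circ>\<^sub>F F) = F" "proj2 \<circ>\<^sub>F (diag \<circ>\<^sub>F F) = F"
    by (simp_all add: fctr_comp_def proj1_def proj2_def diag_def comp_def)
  then have "homotopic U C F (proj1 \<circ>\<^sub>F incl)" "homotopic U C F (proj2 \<circ>\<^sub>F incl)"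
    using homotopic_fctr_comp_left[OF F is_functor_proj1[OF C C]]
      homotopic_fctr_comp_left[OF F is_functor_proj2[OF C C]] by simp_all
  then show "homotopic U C (proj1 \<circ>\<^sub>F incl) (proj2 \<circ>\<^sub>F incl)"
    using catU by (blast intro: homotopic_sym homotopic_trans)
next
  let ?p1 = "proj1 \<circ>\<^sub>F incl :: ('o \<times> 'o, 'a \<times> 'a, 'o, 'a) fctr"
  let ?p2 = "proj2 \<circ>\<^sub>F incl :: ('o \<times> 'o, 'a \<times> 'a, 'o, 'a) fctr"
  assume hom: "homotopic U C ?p1 ?p2"
  have p1: "is_functor U C ?p1"
    using is_functor_fctr_comp is_functor_incl is_functor_proj1 category_prod_cat C U by metis
  have "pair_fctr ?p1 ?p1 = diag \<circ>\<^sub>F ?p1" "pair_fctr ?p1 ?p2 = incl"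
    by (auto simp: pair_fctr_def fctr_comp_def proj1_def proj2_def diag_def incl_def)
  then have "homotopic U (C \<times>\<^sub>C C) (diag \<circ>\<^sub>F ?p1) incl"
    using homotopic_pair_fctr_right[OF p1 hom] by simp
  then show "farber_subcategory C U"
    using U p1 unfolding farber_subcategory_def by blast
qed

theorem theorem3p7:
  fixes C :: "('o, 'a) cat"
  assumes "category C" and "connected_cat C"
  shows "cTC C = cD (C \<times>\<^sub>C C) C proj1 proj2"
proof -
  have "(\<forall>j\<in>{0..n}. farber_subcategory C (U j)) \<longleftrightarrow>
      (\<forall>j\<in>{0..n}. homotopic (U j) C (proj1 \<circ>\<^sub>F incl) (proj2 \<circ>\<^sub>F incl))"
    if "geometric_cover (C \<times>\<^sub>C C) {0..n} U" for n and U :: "nat \<Rightarrow> ('o \<times> 'o, 'a \<times> 'a) cat"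
    using that farber_iff_proj_homotopic[OF assms(1)] unfolding geometric_cover_def by blast
  then show ?thesis
    unfolding cTC_def cD_def by (simp cong: conj_cong)
qed

end
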